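(* Let $L\ge 2$, let $n_0,n_1,\dots,n_L\ge 1$ be integers with $n_L=n_0$ and $\max\{n_j: j=1,\dots,L\}\le n_0$. Let $\phi:\mathbb{R}\to\mathbb{R}$ be continuous and monotonically increasing, let $W_j\in\mathbb{R}^{n_j\times n_{j-1}}$ and $b_j\in\mathbb{R}^{n_j}$ for $j=1,\dots,L$, and let $F:\mathbb{R}^{n_0}\to\mathbb{R}^{n_0}$ be the neural network function (autoencoder) with weights $W_j$, biases $b_j$ and activation function $\phi$. Assume that $$\min\{\operatorname{Rank}(W_j): j=1,\dots,L\}<n_0.$$ If $x^*\in\mathbb{R}^{n_0}$ is an attractive point of $F$, then every connected component of the basin of attraction $B(x^* )$ is unbounded.
   Context: A function $\phi:\mathbb{R}\to\mathbb{R}$ is monotonically increasing if $x<y$ implies $\phi(x)\le\phi(y)$ (not necessarily strictly). It is applied to vectors coordinate-wise. The neural network function $F:=F_L$ with weights $W_j\in\mathbb{R}^{n_j\times n_{j-1}}$, biases $b_j\in\mathbb{R}^{n_j}$ ($j=1,\dots,L$) and activation $\phi$ is defined recursively by $F_1(x)=\phi(W_1x+b_1)$, $F_k(x)=\phi(W_kF_{k-1}(x)+b_k)$ for $k=2,\dots,L-1$, and $F_L(x)=W_LF_{L-1}(x)+b_L$ (no activation in the last layer). Its width is $\max\{n_j: j=1,\dots,L\}$. It is called an autoencoder if $n_L=n_0$. For $f:\mathbb{R}^n\to\mathbb{R}^n$, $f^k$ denotes the $k$-fold composition. A point $x^*\in\mathbb{R}^n$ is an attractive point of $f$ if there is an open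 neighbourhood $\mathcal{O}$ of $x^*$ such that $f^k(x)\to x^*$ as $k\to\infty$ for all $x\in\mathcal{O}$. Its basin of attraction is $B(x^* )=\{x\in\mathbb{R}^n: f^k(x)\to x^* \text{ as } k\to\infty\}$. *)

theory Defs
  imports "HOL-Analysis.Analysis" "Jordan_Normal_Form.DL_Rank"
begin

no_notation Finite_Cartesian_Product.vec_nth (infixl \<open>$\<close> 90)

section \<open>Euclidean space on \<open>carrier_vec n\<close>\<close>

text \<open>
  The layer dimensions form a family \<open>n\<^sub>0, \<dots>, n\<^sub>L\<close> of natural numbers, so the space
  \<open>\<real>\<^sup>n\<close> is represented by \<^term>\<open>carrier_vec n :: real vec set\<close>. The type \<^typ>\<open>real vec\<close> has no
  topology of its own, hence the Euclidean metric is supplied explicitly. It takes \<open>n\<close> as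
  an argument because a \<^locale>\<open>Metric_space\<close> distance must be symmetric on the whole type.
\<close>

definition euclid_dist :: "nat \<Rightarrow> real vec \<Rightarrow> real vec \<Rightarrow> real" where
  "euclid_dist n x y = L2_set (\<lambda>i. x $ i - y $ i) {..<n}"

lemma Metric_space_euclid: "Metric_space (carrier_vec n) (euclid_dist n)"
proof
  fix x y z :: "real vec"
  show "0 \<le> euclid_dist n x y"
    by (simp add: euclid_dist_def)
  show "euclid_dist n x y = euclid_dist n y x"
    by (simp add: euclid_dist_def L2_set_def power2_commute)
  show "euclid_dist n x y = 0 \<longleftrightarrow> x = y" if "x \<in> carrier_vec n" "y \<in> carrier_vec n"
    using that by (auto simp: euclid_dist_def L2_set_eq_0_iff)
  show "euclid_dist n x z \<le> euclid_dist n x y + euclid_dist n y z"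
    using L2_set_triangle_ineq[of "\<lambda>i. x $ i - y $ i" "\<lambda>i. y $ i - z $ i" "{..<n}"]
    by (simp add: euclid_dist_def)
qed

abbreviation euclid_top :: "nat \<Rightarrow> real vec topology" where
  "euclid_top n \<equiv> Metric_space.mtopology (carrier_vec n) (euclid_dist n)"

abbreviation euclid_bounded :: "nat \<Rightarrow> real vec set \<Rightarrow> bool" where
  "euclid_bounded n \<equiv> Metric_space.mbounded (carrier_vec n) (euclid_dist n)"

interpretation euclid: Metric_space "carrier_vec n" "euclid_dist n" for n
  by (rule Metric_space_euclid)


section \<open>Attractive points\<close>

definition attractive_point :: "nat \<Rightarrow> (real vec \<Rightarrow> real vec) \<Rightarrow> real vec \<Rightarrow> bool" where
  "attractive_point n f xs \<longleftrightarrow>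
     xs \<in> carrier_vec n \<and>
     (\<exists>U. openin (euclid_top n) U \<and> xs \<in> U \<and>
          (\<forall>x\<in>U. limitin (euclid_top n) (\<lambda>k. (f ^^ k) x) xs sequentially))"

definition basin_of_attraction :: "nat \<Rightarrow> (real vec \<Rightarrow> real vec) \<Rightarrow> real vec \<Rightarrow> real vec set" where
  "basin_of_attraction n f xs =
     {x \<in> carrier_vec n. limitin (euclid_top n) (\<lambda>k. (f ^^ k) x) xs sequentially}"


section \<open>Neural networks\<close>

text \<open>
  \<open>nn_layer L \<phi> W b k\<close> is the \<open>k\<close>-th layer function \<open>F\<^sub>k\<close> of a network with \<open>L\<close> layers,
  started with \<open>F\<^sub>0 = id\<close>; the activation is omitted in the last layer \<open>k = L\<close>. The
  values \<open>W 0\<close> and \<open>b 0\<close> are never used.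
\<close>

fun nn_layer :: "nat \<Rightarrow> (real \<Rightarrow> real) \<Rightarrow> (nat \<Rightarrow> real mat) \<Rightarrow> (nat \<Rightarrow> real vec) \<Rightarrow>
    nat \<Rightarrow> real vec \<Rightarrow> real vec" where
  "nn_layer L \<phi> W b 0 x = x"
| "nn_layer L \<phi> W b (Suc k) x =
     (let z = W (Suc k) *\<^sub>v nn_layer L \<phi> W b k x + b (Suc k)
      in if Suc k = L then z else map_vec \<phi> z)"

definition neural_network :: "nat \<Rightarrow> (real \<Rightarrow> real) \<Rightarrow> (nat \<Rightarrow> real mat) \<Rightarrow> (nat \<Rightarrow> real vec) \<Rightarrow>
    real vec \<Rightarrow> real vec" where
  "neural_network L \<phi> W b = nn_layer L \<phi> W b L"

text \<open>
  The column rank of a matrix; \<^const>\<open>vec_space.rank\<close> takes the dimension of the ambient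
  space of the columns, i.e. the number of rows.
\<close>

abbreviation mat_rank :: "real mat \<Rightarrow> nat" where
  "mat_rank A \<equiv> vec_space.rank (dim_row A) A"

end

theory Submission
  imports Defs
begin

text \<open>
  Let \<open>k + 1\<close> be the first layer whose matrix \<open>A\<close> has a nonzero kernel vector \<open>v\<close>; all earlier
  layers are then square and invertible. Replace \<open>\<phi>\<close> by \<open>\<phi>\<^sub>e t = \<phi> t + e t\<close>, which for
  \<open>e > 0\<close> is a homeomorphism of the line, so that the map \<open>H\<^sub>e\<close> of the first \<open>k\<close> layers is a
  homeomorphism of \<open>\<real>\<^sup>n\<close>. For a point \<open>x\<close> of a component \<open>C\<close> of the basin \<open>B\<close>, the preimage
  under \<open>H\<^sub>e\<close> of the line \<open>H\<^sub>e x + t v\<close> is an unbounded curve through \<open>x\<close>. If \<open>C\<close> were bounded,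
  the curve would leave \<open>B\<close> at a point \<open>y\<close> of the closure of \<open>C\<close>, and \<open>A (H\<^sub>e y) = A (H\<^sub>e x)\<close>. By
  compactness such a \<open>y\<close> exists for \<open>e = 0\<close> as well, and then \<open>F y = F x\<close>, although \<open>x\<close> lies in
  the basin and \<open>y\<close> does not.
\<close>


section \<open>Coordinates in \<open>carrier_vec n\<close>\<close>

lemma abs_vec_index_diff_le_euclid_dist:
  "i < n \<Longrightarrow> \<bar>x $ i - y $ i\<bar> \<le> euclid_dist n x y"
  using member_le_L2_set[of "{..<n}" i "\<lambda>i. x $ i - y $ i"]
    member_le_L2_set[of "{..<n}" i "\<lambda>i. y $ i - x $ i"] euclid.commute[of n x y]
  by (simp add: euclid_dist_def)

lemma continuous_map_vec_index:
  assumes "i < n"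
  shows "continuous_map (euclid_top n) euclideanreal (\<lambda>x. x $ i)"
proof -
  have "\<exists>U. openin (euclid_top n) U \<and> x \<in> U \<and> (\<forall>y\<in>U. y $ i \<in> Met_TC.mball (x $ i) e)"
    if "x \<in> carrier_vec n" "e > 0" for x :: "real vec" and e :: real
  proof (intro exI conjI ballI)
    show "openin (euclid_top n) (euclid.mball n x e)" by simp
    show "x \<in> euclid.mball n x e" using that by simp
    fix y assume "y \<in> euclid.mball n x e"
    then have "euclid_dist n x y < e" by simp
    with abs_vec_index_diff_le_euclid_dist[OF assms, of x y]
    show "y $ i \<in> Met_TC.mball (x $ i) e" by (simp add: dist_real_def)
  qed
  then show ?thesis
    by (simp add: Met_TC.continuous_map_to_metric[simplified])
qed

text \<open>All later continuity proofs are reduced to real coordinates by this criterion. From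
  right to left, the distance to the fixed point \<open>f x\<close> is a continuous expression in
  the coordinates, so the preimage of a ball around \<open>f x\<close> is open.\<close>

lemma continuous_map_euclid_top_iff:
  "continuous_map X (euclid_top n) f \<longleftrightarrow>
     (\<forall>x\<in>topspace X. f x \<in> carrier_vec n) \<and>
     (\<forall>i<n. continuous_map X euclideanreal (\<lambda>x. f x $ i))" (is "?L \<longleftrightarrow> ?R")
proof
  assume L: ?L
  have "\<forall>x\<in>topspace X. f x \<in> carrier_vec n"
    using continuous_map_image_subset_topspace[OF L] by auto
  moreover have "continuous_map X euclideanreal (\<lambda>x. f x $ i)" if "i < n" for i
    using continuous_map_compose[OF L continuous_map_vec_index[OF that]] by (simp add: o_def)
  ultimately show ?R by blast
next
  assume R: ?R
  show ?L
    unfolding euclid.continuous_map_to_metric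
  proof (intro ballI allI impI)
    fix x and e :: real assume x: "x \<in> topspace X" and e: "e > 0"
    have c: "continuous_map X euclideanreal (\<lambda>y. euclid_dist n (f x) (f y))"
      unfolding euclid_dist_def L2_set_def
      by (intro continuous_intros) (use R in auto)
    have "openin X {y \<in> topspace X. euclid_dist n (f x) (f y) \<in> {..<e}}"
      by (rule openin_continuous_map_preimage[OF c]) simp
    moreover have "euclid_dist n (f x) (f x) = 0"
      by (simp add: euclid_dist_def L2_set_def)
    ultimately show "\<exists>U. openin X U \<and> x \<in> U \<and> (\<forall>y\<in>U. f y \<in> euclid.mball n (f x) e)"
      using x e R by (intro exI[of _ "{y \<in> topspace X. euclid_dist n (f x) (f y) \<in> {..<e}}"]) auto
  qed
qed

lemma continuous_map_mult_mat_vec: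
  assumes "A \<in> carrier_mat m n" "continuous_map X (euclid_top n) f"
  shows "continuous_map X (euclid_top m) (\<lambda>x. A *\<^sub>v f x)"
proof -
  have f: "\<And>x. x \<in> topspace X \<Longrightarrow> f x \<in> carrier_vec n"
    and c: "\<And>i. i < n \<Longrightarrow> continuous_map X euclideanreal (\<lambda>x. f x $ i)"
    using assms(2) by (auto simp: continuous_map_euclid_top_iff)
  have "continuous_map X euclideanreal (\<lambda>x. (A *\<^sub>v f x) $ i)" if "i < m" for i
  proof (rule continuous_map_eq)
    show "continuous_map X euclideanreal (\<lambda>x. \<Sum>j<n. A $$ (i, j) * f x $ j)"
      by (intro continuous_map_sum continuous_map_real_mult) (use c in auto)
    fix x assume "x \<in> topspace X"
    from f[OF this] that assms(1)
    show "(\<Sum>j<n. A $$ (i, j) * f x $ j) = (A *\<^sub>v f x) $ i"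
      by (auto simp: scalar_prod_def lessThan_atLeast0 intro!: sum.cong)
  qed
  then show ?thesis using assms(1) f by (auto simp: continuous_map_euclid_top_iff)
qed

lemma continuous_map_affine_vec:
  assumes "A \<in> carrier_mat m n" "c \<in> carrier_vec m" "continuous_map X (euclid_top n) f"
  shows "continuous_map X (euclid_top m) (\<lambda>x. A *\<^sub>v f x + c)"
proof -
  have "continuous_map X (euclid_top m) (\<lambda>x. A *\<^sub>v f x)"
    by (rule continuous_map_mult_mat_vec[OF assms(1,3)])
  then show ?thesis
    using assms(1,2) unfolding continuous_map_euclid_top_iff
    by (auto intro!: continuous_map_add)
qed

section \<open>Compactness of cubes\<close>

text \<open>A cube rather than a ball, because its compactness follows from that of a product of
  intervals.\<close>

definition euclid_box :: "nat \<Rightarrow> real \<Rightarrow> real vec set" where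
  "euclid_box n r = {x \<in> carrier_vec n. \<forall>i<n. \<bar>x $ i\<bar> \<le> r}"

lemma compactin_euclid_box: "compactin (euclid_top n) (euclid_box n r)"
proof -
  let ?P = "product_topology (\<lambda>_. euclideanreal) {..<n}"
  have "compactin ?P (PiE {..<n} (\<lambda>_. {-r..r}))"
    by (simp add: compactin_PiE)
  moreover have "continuous_map ?P (euclid_top n) (vec n)"
    using continuous_map_product_coordinates[of _ "{..<n}" "\<lambda>_. euclideanreal"]
    by (auto simp: continuous_map_euclid_top_iff)
  ultimately have "compactin (euclid_top n) (vec n ` PiE {..<n} (\<lambda>_. {-r..r}))"
    by (rule image_compactin)
  moreover have "vec n ` PiE {..<n} (\<lambda>_. {-r..r}) = euclid_box n r" (is "?A = _")
  proof (intro equalityI subsetI)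
    fix x assume x: "x \<in> euclid_box n r"
    \<comment> \<open>\<open>PiE\<close> admits only extensional functions, hence the restriction to
      \<open>{..<n}\<close>.\<close>
    then have "x = vec n (\<lambda>i\<in>{..<n}. x $ i)" by (auto simp: euclid_box_def)
    moreover have "(\<lambda>i\<in>{..<n}. x $ i) \<in> PiE {..<n} (\<lambda>_. {-r..r})"
      using x by (auto simp: euclid_box_def abs_le_iff)
    ultimately show "x \<in> ?A" by blast
  qed (auto simp: euclid_box_def abs_le_iff PiE_def Pi_def)
  ultimately show ?thesis by simp
qed

lemma closedin_euclid_box: "closedin (euclid_top n) (euclid_box n r)"
  by (rule compactin_imp_closedin[OF euclid.Hausdorff_space_mtopology compactin_euclid_box])

lemma euclid_bounded_imp_subset_box:
  assumes "euclid_bounded n C"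
  obtains r where "C \<subseteq> euclid_box n r"
proof -
  from assms obtain a R where C: "C \<subseteq> euclid.mcball n a R"
    unfolding euclid.mbounded_def by blast
  have "\<bar>x $ i\<bar> \<le> R + (\<Sum>i<n. \<bar>a $ i\<bar>)" if "x \<in> C" "i < n" for x i
  proof -
    have "euclid_dist n a x \<le> R" using C that by auto
    moreover have "\<bar>a $ i - x $ i\<bar> \<le> euclid_dist n a x"
      by (rule abs_vec_index_diff_le_euclid_dist[OF that(2)])
    moreover have "\<bar>a $ i\<bar> \<le> (\<Sum>i<n. \<bar>a $ i\<bar>)"
      using that(2) by (intro member_le_sum) auto
    ultimately show ?thesis by linarith
  qed
  then show thesis using C by (intro that[of "R + (\<Sum>i<n. \<bar>a $ i\<bar>)"]) (auto simp: euclid_box_def)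
qed


section \<open>Matrices\<close>

text \<open>Padding \<open>A\<close> with zero rows gives a square matrix \<open>B\<close>. Its row
  \<open>m\<close> vanishes, so the transpose kills \<open>unit_vec n m\<close> and
  \<open>det B = 0\<close>; a kernel vector of \<open>B\<close> is one of \<open>A\<close>.\<close>

lemma wide_mat_nontrivial_kernel:
  fixes A :: "'a :: field mat"
  assumes A: "A \<in> carrier_mat m n" and "m < n"
  shows "\<exists>v\<in>carrier_vec n. v \<noteq> 0\<^sub>v n \<and> A *\<^sub>v v = 0\<^sub>v m"
proof -
  define B where "B = mat n n (\<lambda>(i, j). if i < m then A $$ (i, j) else 0)"
  have B: "B \<in> carrier_mat n n" by (simp add: B_def)
  have "transpose_mat B \<in> carrier_mat n n" using B by simp
  moreover have "transpose_mat B *\<^sub>v unit_vec n m = 0\<^sub>v n"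
    using \<open>m < n\<close> by (intro eq_vecI) (auto simp: B_def scalar_prod_def unit_vec_def intro!: sum.neutral)
  moreover have "unit_vec n m \<noteq> (0\<^sub>v n :: 'a vec)"
  proof
    assume "unit_vec n m = (0\<^sub>v n :: 'a vec)"
    then have "unit_vec n m $ m = (0\<^sub>v n $ m :: 'a)" by simp
    then show False using \<open>m < n\<close> by simp
  qed
  ultimately have "det (transpose_mat B) = 0"
    using B det_0_iff_vec_prod_zero_field[of "transpose_mat B" n] unit_vec_carrier[of n m] by blast
  then have "det B = 0" using det_transpose[OF B] by simp
  then obtain v where v: "v \<in> carrier_vec n" "v \<noteq> 0\<^sub>v n" "B *\<^sub>v v = 0\<^sub>v n"
    using det_0_iff_vec_prod_zero_field[OF B] by blast
  have "A *\<^sub>v v = 0\<^sub>v m"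
  proof (rule eq_vecI)
    fix i assume i: "i < dim_vec (0\<^sub>v m :: 'a vec)"
    have "(A *\<^sub>v v) $ i = (B *\<^sub>v v) $ i"
      using i A v(1) \<open>m < n\<close> by (auto simp: B_def scalar_prod_def)
    also have "\<dots> = 0" using v(3) i \<open>m < n\<close> by simp
    finally show "(A *\<^sub>v v) $ i = 0\<^sub>v m $ i" using i by simp
  qed (use A in auto)
  with v show ?thesis by blast
qed

lemma trivial_kernel_inverse:
  fixes A :: "'a :: field mat"
  assumes A: "A \<in> carrier_mat n n"
    and inj: "\<And>v. v \<in> carrier_vec n \<Longrightarrow> A *\<^sub>v v = 0\<^sub>v n \<Longrightarrow> v = 0\<^sub>v n"
  obtains B where "B \<in> carrier_mat n n" "A * B = 1\<^sub>m n" "B * A = 1\<^sub>m n"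
proof -
  have "det A \<noteq> 0" using det_0_iff_vec_prod_zero_field[OF A] inj by blast
  from det_non_zero_imp_unit[OF A this, of undefined]
  show thesis using that by (auto simp: Units_def ring_mat_def)
qed

lemma rank_deficient_nontrivial_kernel:
  fixes A :: "real mat"
  assumes A: "A \<in> carrier_mat n n" and "mat_rank A < n"
  shows "\<exists>v\<in>carrier_vec n. v \<noteq> 0\<^sub>v n \<and> A *\<^sub>v v = 0\<^sub>v n"
proof -
  have "det A = 0"
    using assms vec_space.det_rank_iff[OF A] by auto
  then show ?thesis using det_0_iff_vec_prod_zero_field[OF A] by blast
qed


section \<open>Basins of attraction\<close>

lemma continuous_map_funpow:
  "continuous_map X X f \<Longrightarrow> continuous_map X X (f ^^ k)"
proof (induction k)
  case (Suc k)
  then show ?case using continuous_map_compose[of X X "f ^^ k" X f] by (simp add: o_def)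
qed (simp add: id_def)

text \<open>Convergence of an orbit depends only on its tail, so membership in the basin can be
  pulled back along iterates. This serves both the openness of the basin and the final
  contradiction.\<close>

lemma funpow_in_basin_imp:
  assumes "(f ^^ k) x \<in> basin_of_attraction n f xs" "x \<in> carrier_vec n"
  shows "x \<in> basin_of_attraction n f xs"
proof -
  have "limitin (euclid_top n) (\<lambda>i. (f ^^ (i + k)) x) xs sequentially"
    using assms(1) by (simp add: basin_of_attraction_def funpow_add)
  then show ?thesis
    using assms(2) limitin_sequentially_offset_rev[of _ "\<lambda>i. (f ^^ i) x" k]
    by (simp add: basin_of_attraction_def)
qed

lemma basin_image:
  assumes "continuous_map (euclid_top n) (euclid_top n) f" "x \<in> basin_of_attraction n f xs"
  shows "f x \<in> basin_of_attraction n f xs"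
proof -
  have "limitin (euclid_top n) (\<lambda>i. (f ^^ (i + 1)) x) xs sequentially"
    using assms(2) limitin_sequentially_offset[of _ "\<lambda>i. (f ^^ i) x" _ 1]
    by (simp add: basin_of_attraction_def)
  moreover have "f x \<in> carrier_vec n"
    using assms by (simp add: continuous_map_euclid_top_iff basin_of_attraction_def)
  ultimately show ?thesis
    by (simp add: basin_of_attraction_def funpow_swap1)
qed

text \<open>The basin is the union of the preimages of the attracting neighbourhood \<open>U\<close>
  under all iterates: an orbit converging to \<open>xs\<close> enters \<open>U\<close>, and an orbit
  that enters \<open>U\<close> converges to \<open>xs\<close>.\<close>

lemma openin_basin:
  assumes f: "continuous_map (euclid_top n) (euclid_top n) f" and "attractive_point n f xs"
  shows "openin (euclid_top n) (basin_of_attraction n f xs)"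
proof -
  obtain U where U: "openin (euclid_top n) U" "xs \<in> U"
    "\<And>x. x \<in> U \<Longrightarrow> limitin (euclid_top n) (\<lambda>k. (f ^^ k) x) xs sequentially"
    using assms(2) by (auto simp: attractive_point_def)
  have UC: "U \<subseteq> carrier_vec n" using openin_subset[OF U(1)] by simp
  have "basin_of_attraction n f xs = (\<Union>k. {x \<in> topspace (euclid_top n). (f ^^ k) x \<in> U})"
  proof (intro equalityI subsetI)
    fix x assume x: "x \<in> basin_of_attraction n f xs"
    then have "limitin (euclid_top n) (\<lambda>k. (f ^^ k) x) xs sequentially"
      by (simp add: basin_of_attraction_def)
    then obtain k where "(f ^^ k) x \<in> U"
      using U(1,2) unfolding limitin_sequentially by blast
    with x show "x \<in> (\<Union>k. {x \<in> topspace (euclid_top n). (f ^^ k) x \<in> U})"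
      by (auto simp: basin_of_attraction_def)
  next
    fix x assume "x \<in> (\<Union>k. {x \<in> topspace (euclid_top n). (f ^^ k) x \<in> U})"
    then obtain k where k: "(f ^^ k) x \<in> U" and x: "x \<in> carrier_vec n" by auto
    have "(f ^^ k) x \<in> basin_of_attraction n f xs"
      using k U(3) UC by (auto simp: basin_of_attraction_def)
    from funpow_in_basin_imp[OF this x] show "x \<in> basin_of_attraction n f xs" .
  qed
  moreover have "openin (euclid_top n) (\<Union>k. {x \<in> topspace (euclid_top n). (f ^^ k) x \<in> U})"
    by (rule openin_Union) (use openin_continuous_map_preimage[OF continuous_map_funpow[OF f] U(1)] in blast)
  ultimately show ?thesis by (simp only:)
qed

section \<open>Curves leaving a component of an open set\<close>

text \<open>Before its first exit from \<open>B\<close> the curve stays in the component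
  \<open>C\<close>, hence in \<open>K\<close>. The exit point is a limit of these earlier points, so
  it lies in the closed set \<open>K\<close>, but not in the open set \<open>B\<close>.\<close>

lemma curve_exits_component:
  fixes \<gamma> :: "real \<Rightarrow> 'a"
  assumes B: "openin X B" and K: "closedin X K" and C: "C \<in> connected_components_of (subtopology X B)"
    and "C \<subseteq> K" and \<gamma>: "continuous_map euclideanreal X \<gamma>"
    and "\<gamma> 0 \<in> C" and "0 \<le> t" "\<gamma> t \<notin> K"
  shows "\<exists>s. \<gamma> s \<in> K - B"
proof -
  define S where "S = {s. 0 \<le> s \<and> \<gamma> s \<notin> B}"
  have CB: "C \<subseteq> B" using connectedin_connected_components_of[OF C] by (simp add: connectedin_subtopology)
  have in_C: "\<gamma> s \<in> C" if s: "0 \<le> s" "\<And>u. 0 \<le> u \<Longrightarrow> u \<le> s \<Longrightarrow> \<gamma> u \<in> B" for s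
  proof -
    have "connectedin X (\<gamma> ` {0..s})"
      by (rule connectedin_continuous_map_image[OF \<gamma>]) simp
    then have "connectedin (subtopology X B) (\<gamma> ` {0..s})"
      using s by (auto simp: connectedin_subtopology)
    moreover have "\<not> disjnt C (\<gamma> ` {0..s})"
      using s(1) \<open>\<gamma> 0 \<in> C\<close> by (force simp: disjnt_iff)
    ultimately have "\<gamma> ` {0..s} \<subseteq> C" by (rule connected_components_of_maximal[OF C])
    then show ?thesis using s(1) by auto
  qed
  have "open (\<gamma> -` B)"
    using openin_continuous_map_preimage[OF \<gamma> B] by (simp add: vimage_def)
  then have "closed ({0..} - \<gamma> -` B)" by (intro closed_Diff) auto
  moreover have "{0..} - \<gamma> -` B = S" by (auto simp: S_def)
  ultimately have "closed S" by simp
  \<comment> \<open>A curve that never left \<open>B\<close> would remain in \<open>C\<close> and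
    hence in \<open>K\<close>, contrary to the choice of \<open>t\<close>.\<close>
  moreover have "S \<noteq> {}"
  proof
    assume "S = {}"
    then have "\<gamma> t \<in> C" by (intro in_C \<open>0 \<le> t\<close>) (auto simp: S_def)
    with \<open>\<gamma> t \<notin> K\<close> \<open>C \<subseteq> K\<close> show False by blast
  qed
  moreover have bdd: "bdd_below S" by (rule bdd_belowI[of _ 0]) (simp add: S_def)
  ultimately have Inf: "Inf S \<in> S" by (intro closed_contains_Inf)
  then have Inf_S: "0 \<le> Inf S" "\<gamma> (Inf S) \<notin> B" unfolding S_def by blast+
  have before: "\<gamma> s \<in> B" if "0 \<le> s" "s < Inf S" for s
  proof -
    have "s \<notin> S" using cInf_lower[OF _ bdd, of s] that(2) by linarith
    then show ?thesis using that(1) by (simp add: S_def)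
  qed
  \<comment> \<open>A positive exit time makes \<open>{0..<Inf S}\<close> nonempty, so that
    \<open>Inf S\<close> belongs to its closure.\<close>
  have "Inf S \<noteq> 0" using Inf_S(2) subsetD[OF CB \<open>\<gamma> 0 \<in> C\<close>] by auto
  with Inf_S(1) have "0 < Inf S" by simp
  have "closed (\<gamma> -` K)"
    using closedin_continuous_map_preimage[OF \<gamma> K] by (simp add: vimage_def)
  moreover have "{0..<Inf S} \<subseteq> \<gamma> -` K"
  proof
    fix s assume "s \<in> {0..<Inf S}"
    then have "\<gamma> s \<in> C" by (intro in_C before) auto
    then show "s \<in> \<gamma> -` K" using \<open>C \<subseteq> K\<close> by auto
  qed
  ultimately have "closure {0..<Inf S} \<subseteq> \<gamma> -` K" by (intro closure_minimal)
  moreover have "Inf S \<in> closure {0..<Inf S}" using closure_atLeastLessThan[OF \<open>0 < Inf S\<close>] Inf_S(1) by simp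
  ultimately have "\<gamma> (Inf S) \<in> K" by blast
  then show ?thesis using Inf_S(2) by blast
qed

text \<open>Pulling back a line in the kernel direction \<open>v\<close> by \<open>H\<close> gives a
  curve inside one fibre of \<open>A\<close> after \<open>H\<close>. The image of the compact box
  under \<open>H\<close> is bounded and the line is not, so the curve leaves the box and
  \<open>curve_exits_component\<close> applies.\<close>

lemma fiber_exits_component:
  assumes H: "homeomorphic_map (euclid_top n) (euclid_top n) H"
    and A: "A \<in> carrier_mat m n" and v: "v \<in> carrier_vec n" "v \<noteq> 0\<^sub>v n" "A *\<^sub>v v = 0\<^sub>v m"
    and B: "openin (euclid_top n) B"
    and C: "C \<in> connected_components_of (subtopology (euclid_top n) B)"
    and box: "C \<subseteq> euclid_box n r" and x: "x \<in> C"
  shows "\<exists>y \<in> euclid_box n r - B. A *\<^sub>v H y = A *\<^sub>v H x"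
proof -
  obtain G where G: "homeomorphic_maps (euclid_top n) (euclid_top n) H G"
    using H by (auto simp: homeomorphic_map_maps)
  then have contH: "continuous_map (euclid_top n) (euclid_top n) H"
    and contG: "continuous_map (euclid_top n) (euclid_top n) G"
    and GH: "\<And>y. y \<in> carrier_vec n \<Longrightarrow> G (H y) = y"
    and HG: "\<And>y. y \<in> carrier_vec n \<Longrightarrow> H (G y) = y"
    by (auto simp: homeomorphic_maps_def)
  have xc: "x \<in> carrier_vec n" using box x by (auto simp: euclid_box_def)
  have Hx: "H x \<in> carrier_vec n" using contH xc by (simp add: continuous_map_euclid_top_iff)
  obtain i where i: "i < n" "v $ i \<noteq> 0"
    using v(1,2) by (metis carrier_vecD eq_vecI index_zero_vec(1) index_zero_vec(2))
  define l where "l = (\<lambda>t. H x + t \<cdot>\<^sub>v v)"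
  have lc: "l t \<in> carrier_vec n" for t using Hx v(1) by (simp add: l_def)
  have l: "continuous_map euclideanreal (euclid_top n) l"
    using Hx v(1) unfolding continuous_map_euclid_top_iff
    by (auto simp: l_def intro!: continuous_intros)
  have cont: "continuous_map euclideanreal (euclid_top n) (\<lambda>t. G (l t))"
    using continuous_map_compose[OF l contG] by (simp add: o_def)
  have G0: "G (l 0) = x"
  proof -
    have "l 0 = H x" using Hx v(1) by (auto simp: l_def)
    then show ?thesis using GH xc by simp
  qed
  have AH: "A *\<^sub>v H (G (l t)) = A *\<^sub>v H x" for t
  proof -
    have "A *\<^sub>v l t = A *\<^sub>v H x + t \<cdot>\<^sub>v (A *\<^sub>v v)"
      using A Hx v(1) by (simp add: l_def mult_add_distrib_mat_vec mult_mat_vec)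
    also have "\<dots> = A *\<^sub>v H x" using A Hx v(3) by auto
    finally show ?thesis using HG lc by simp
  qed
  have "compactin euclideanreal ((\<lambda>y. H y $ i) ` euclid_box n r)"
    by (rule image_compactin[OF compactin_euclid_box])
      (use contH i(1) in \<open>simp add: continuous_map_euclid_top_iff\<close>)
  then have "bounded ((\<lambda>y. H y $ i) ` euclid_box n r)" by (simp add: compact_imp_bounded)
  then obtain M where M: "\<And>y. y \<in> euclid_box n r \<Longrightarrow> \<bar>H y $ i\<bar> \<le> M"
    by (auto simp: bounded_iff)
  \<comment> \<open>Chosen so that \<open>t * v $ i\<close> outweighs \<open>H x $ i\<close> by more
    than \<open>M\<close>, the bound for this coordinate of \<open>H\<close> on the box.\<close>
  define t where "t = (\<bar>M\<bar> + \<bar>H x $ i\<bar> + 1) / \<bar>v $ i\<bar>"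
  have t: "0 \<le> t" by (simp add: t_def)
  have tv: "\<bar>t * v $ i\<bar> = \<bar>M\<bar> + \<bar>H x $ i\<bar> + 1"
    using i(2) by (simp add: t_def abs_mult)
  have "G (l t) \<notin> euclid_box n r"
  proof
    assume "G (l t) \<in> euclid_box n r"
    from M[OF this] have "\<bar>l t $ i\<bar> \<le> M" using HG lc by simp
    moreover have "l t $ i = H x $ i + t * v $ i" using Hx v(1) i(1) by (simp add: l_def)
    ultimately show False using tv by linarith
  qed
  with curve_exits_component[OF B closedin_euclid_box C box cont _ t] G0 x
  obtain s where "G (l s) \<in> euclid_box n r - B" by auto
  then show ?thesis using AH by blast
qed


section \<open>Networks\<close>

text \<open>Since \<open>\<phi>\<close> is monotone, adding \<open>e * t\<close> makes distances
  grow at least by the factor \<open>e\<close>. This gives injectivity, values unbounded on both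
  sides and thus surjectivity, and an inverse with Lipschitz constant \<open>1 / e\<close>.\<close>

lemma homeomorphic_map_add_linear:
  fixes \<phi> :: "real \<Rightarrow> real"
  assumes "continuous_on UNIV \<phi>" "mono \<phi>" "0 < e"
  shows "homeomorphic_map euclideanreal euclideanreal (\<lambda>t. \<phi> t + e * t)"
proof -
  define \<psi> where "\<psi> = (\<lambda>t. \<phi> t + e * t)"
  have cont: "continuous_on UNIV \<psi>"
    unfolding \<psi>_def by (intro continuous_intros assms(1))
  have expand: "e * (u - w) \<le> \<psi> u - \<psi> w" if "w \<le> u" for u w
    using monoD[OF assms(2) that] by (simp add: \<psi>_def algebra_simps)
  have expand_abs: "e * \<bar>u - w\<bar> \<le> \<bar>\<psi> u - \<psi> w\<bar>" for u w
    using expand[of u w] expand[of w u] by (cases "u \<le> w") auto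
  have inj: "inj \<psi>"
  proof (rule injI)
    fix u w assume "\<psi> u = \<psi> w"
    then show "u = w" using expand_abs[of u w] \<open>0 < e\<close> by (simp add: mult_le_0_iff)
  qed
  have "\<exists>u. \<psi> u = y" for y
  proof -
    \<comment> \<open>At \<open>q\<close> and \<open>-q\<close> the linear term alone shifts the
      value \<open>\<psi> 0\<close> by at least the gap to \<open>y\<close>, so \<open>y\<close>
      lies between the two values.\<close>
    define q where "q = \<bar>y - \<psi> 0\<bar> / e"
    have q: "0 \<le> q" "e * q = \<bar>y - \<psi> 0\<bar>" using \<open>0 < e\<close> by (auto simp: q_def)
    have "\<psi> (-q) \<le> y" "y \<le> \<psi> q"
      using expand[of "-q" 0] expand[of 0 q] q by auto
    then show ?thesis
      using IVT'[of \<psi> "-q" y q] q(1) continuous_on_subset[OF cont] by auto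
  qed
  then have surj: "surj \<psi>" by (metis surjI)
  have "continuous_on UNIV (inv_into UNIV \<psi>)"
  proof (rule lipschitz_on_continuous_on)
    show "(1 / e)-lipschitz_on UNIV (inv_into UNIV \<psi>)"
    proof (rule lipschitz_onI)
      fix a c :: real
      show "dist (inv_into UNIV \<psi> a) (inv_into UNIV \<psi> c) \<le> 1 / e * dist a c"
        using expand_abs[of "inv_into UNIV \<psi> a" "inv_into UNIV \<psi> c"] \<open>0 < e\<close> surj
        by (simp add: dist_real_def surj_f_inv_f field_simps)
    qed (use \<open>0 < e\<close> in simp)
  qed
  then have "homeomorphic_maps euclideanreal euclideanreal \<psi> (inv_into UNIV \<psi>)"
    using cont inj surj by (simp add: homeomorphic_maps_def surj_f_inv_f)
  then show ?thesis unfolding \<psi>_def[symmetric] by (rule homeomorphic_maps_imp_map)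
qed

lemma homeomorphic_map_map_vec:
  assumes "homeomorphic_map euclideanreal euclideanreal \<psi>"
  shows "homeomorphic_map (euclid_top n) (euclid_top n) (map_vec \<psi>)"
proof -
  obtain \<sigma> where \<sigma>: "homeomorphic_maps euclideanreal euclideanreal \<psi> \<sigma>"
    using assms by (auto simp: homeomorphic_map_maps)
  have cont: "continuous_map (euclid_top n) (euclid_top n) (map_vec g)"
    if g: "continuous_map euclideanreal euclideanreal g" for g
    unfolding continuous_map_euclid_top_iff
  proof (intro conjI ballI allI impI)
    fix i assume "i < n"
    from continuous_map_compose[OF continuous_map_vec_index[OF this] g]
    have c: "continuous_map (euclid_top n) euclideanreal (\<lambda>x. g (x $ i))" by (simp add: o_def)
    show "continuous_map (euclid_top n) euclideanreal (\<lambda>x. map_vec g x $ i)"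
      by (rule continuous_map_eq[OF c]) (use \<open>i < n\<close> in auto)
  qed simp
  have "homeomorphic_maps (euclid_top n) (euclid_top n) (map_vec \<psi>) (map_vec \<sigma>)"
    using \<sigma> cont unfolding homeomorphic_maps_def by (auto intro!: eq_vecI)
  then show ?thesis by (rule homeomorphic_maps_imp_map)
qed

lemma homeomorphic_map_affine_vec:
  assumes A: "A \<in> carrier_mat n n" and c: "c \<in> carrier_vec n"
    and inj: "\<And>v. v \<in> carrier_vec n \<Longrightarrow> A *\<^sub>v v = 0\<^sub>v n \<Longrightarrow> v = 0\<^sub>v n"
  shows "homeomorphic_map (euclid_top n) (euclid_top n) (\<lambda>x. A *\<^sub>v x + c)"
proof -
  obtain B where B: "B \<in> carrier_mat n n" "A * B = 1\<^sub>m n" "B * A = 1\<^sub>m n"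
    using trivial_kernel_inverse[OF A inj] by metis
  let ?g = "\<lambda>x. B *\<^sub>v (x - c)"
  have "continuous_map (euclid_top n) (euclid_top n) (\<lambda>x. A *\<^sub>v x + c)"
    by (rule continuous_map_affine_vec[OF A c]) simp
  moreover have "continuous_map (euclid_top n) (euclid_top n) (\<lambda>x. x - c)"
    using c by (auto simp: continuous_map_euclid_top_iff intro!: continuous_map_diff continuous_map_vec_index)
  then have "continuous_map (euclid_top n) (euclid_top n) ?g"
    by (rule continuous_map_mult_mat_vec[OF B(1)])
  moreover have "?g (A *\<^sub>v x + c) = x" if x: "x \<in> carrier_vec n" for x
  proof -
    have "A *\<^sub>v x + c - c = A *\<^sub>v x" using A c by (intro eq_vecI) auto
    moreover have "B *\<^sub>v (A *\<^sub>v x) = (B * A) *\<^sub>v x" using A B(1) x by simp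
    ultimately show ?thesis using x B(3) by simp
  qed
  moreover have "A *\<^sub>v ?g x + c = x" if x: "x \<in> carrier_vec n" for x
  proof -
    have "A *\<^sub>v (B *\<^sub>v (x - c)) = (A * B) *\<^sub>v (x - c)" using A B(1) c x by simp
    also have "\<dots> = x - c" using B(2) c x by simp
    finally show ?thesis using c x by auto
  qed
  ultimately have "homeomorphic_maps (euclid_top n) (euclid_top n) (\<lambda>x. A *\<^sub>v x + c) ?g"
    unfolding homeomorphic_maps_def by simp
  then show ?thesis by (rule homeomorphic_maps_imp_map)
qed

text \<open>By \<open>k < L\<close> the last layer, which omits the activation, is not reached:
  every layer here is an invertible affine map followed by a coordinatewise homeomorphism.\<close>

lemma homeomorphic_map_nn_layer:
  assumes "homeomorphic_map euclideanreal euclideanreal \<psi>"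
    and "\<And>i. i \<in> {1..k} \<Longrightarrow> W i \<in> carrier_mat n n"
    and "\<And>i. i \<in> {1..k} \<Longrightarrow> b i \<in> carrier_vec n"
    and "\<And>i v. i \<in> {1..k} \<Longrightarrow> v \<in> carrier_vec n \<Longrightarrow> W i *\<^sub>v v = 0\<^sub>v n \<Longrightarrow> v = 0\<^sub>v n"
    and "k < L"
  shows "homeomorphic_map (euclid_top n) (euclid_top n) (nn_layer L \<psi> W b k)"
  using assms(2-)
proof (induction k)
  case 0
  have "nn_layer L \<psi> W b 0 = id" by (auto simp: fun_eq_iff)
  then show ?case using homeomorphic_map_id[of "euclid_top n" "euclid_top n"] by (simp only:)
next
  case (Suc k)
  have "homeomorphic_map (euclid_top n) (euclid_top n) (nn_layer L \<psi> W b k)"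
  proof (rule Suc.IH)
    show "v = 0\<^sub>v n" if "i \<in> {1..k}" "v \<in> carrier_vec n" "W i *\<^sub>v v = 0\<^sub>v n" for i v
      using Suc.prems(3)[of i v] that by simp
  qed (use Suc.prems in auto)
  moreover have "homeomorphic_map (euclid_top n) (euclid_top n) (\<lambda>x. W (Suc k) *\<^sub>v x + b (Suc k))"
  proof (rule homeomorphic_map_affine_vec)
    show "v = 0\<^sub>v n" if "v \<in> carrier_vec n" "W (Suc k) *\<^sub>v v = 0\<^sub>v n" for v
      using Suc.prems(3)[of "Suc k" v] that by simp
  qed (use Suc.prems in auto)
  moreover have "homeomorphic_map (euclid_top n) (euclid_top n) (map_vec \<psi>)"
    by (rule homeomorphic_map_map_vec[OF assms(1)])
  ultimately have "homeomorphic_map (euclid_top n) (euclid_top n)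
      (map_vec \<psi> \<circ> ((\<lambda>x. W (Suc k) *\<^sub>v x + b (Suc k)) \<circ> nn_layer L \<psi> W b k))"
    by (blast intro: homeomorphic_map_compose)
  moreover have "map_vec \<psi> \<circ> ((\<lambda>x. W (Suc k) *\<^sub>v x + b (Suc k)) \<circ> nn_layer L \<psi> W b k) =
      nn_layer L \<psi> W b (Suc k)"
    using Suc.prems by (auto simp: fun_eq_iff Let_def)
  ultimately show ?case by (simp only:)
qed

text \<open>The slope \<open>e\<close> and the input \<open>f\<close> both vary over a space
  \<open>X\<close>. Taking pairs of slope and input as \<open>X\<close> gives the joint continuity
  that the limit to slope 0 needs; the constant slope 0 gives continuity of the network
  itself.\<close>

lemma continuous_map_nn_layer:
  assumes \<phi>: "continuous_on UNIV \<phi>"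
    and W: "\<And>j. j \<in> {1..L} \<Longrightarrow> W j \<in> carrier_mat (n j) (n (j - 1))"
    and b: "\<And>j. j \<in> {1..L} \<Longrightarrow> b j \<in> carrier_vec (n j)"
    and e: "continuous_map X euclideanreal e"
    and f: "continuous_map X (euclid_top (n 0)) f"
    and "k \<le> L"
  shows "continuous_map X (euclid_top (n k)) (\<lambda>x. nn_layer L (\<lambda>t. \<phi> t + e x * t) W b k (f x))"
  using \<open>k \<le> L\<close>
proof (induction k)
  case 0
  then show ?case using f by simp
next
  case (Suc k)
  define z where "z = (\<lambda>x. W (Suc k) *\<^sub>v nn_layer L (\<lambda>t. \<phi> t + e x * t) W b k (f x) + b (Suc k))"
  have z: "continuous_map X (euclid_top (n (Suc k))) z"
    unfolding z_def using Suc W[of "Suc k"] b[of "Suc k"]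
    by (intro continuous_map_affine_vec) auto
  show ?case
  proof (cases "Suc k = L")
    case True
    then have "nn_layer L (\<lambda>t. \<phi> t + e x * t) W b (Suc k) (f x) = z x" for x
      unfolding nn_layer.simps Let_def z_def by simp
    then show ?thesis using z by presburger
  next
    case False
    have zc: "\<And>x. x \<in> topspace X \<Longrightarrow> z x \<in> carrier_vec (n (Suc k))"
      and zi: "\<And>i. i < n (Suc k) \<Longrightarrow> continuous_map X euclideanreal (\<lambda>x. z x $ i)"
      using z by (auto simp: continuous_map_euclid_top_iff)
    have "continuous_map X euclideanreal (\<lambda>x. map_vec (\<lambda>t. \<phi> t + e x * t) (z x) $ i)"
      if i: "i < n (Suc k)" for i
    proof (rule continuous_map_eq)
      have "continuous_map X euclideanreal (\<lambda>x. \<phi> (z x $ i))"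
        using continuous_map_compose[OF zi[OF i], of euclideanreal \<phi>] \<phi> by (simp add: o_def)
      then show "continuous_map X euclideanreal (\<lambda>x. \<phi> (z x $ i) + e x * z x $ i)"
        by (intro continuous_map_add continuous_map_real_mult e zi[OF i])
      show "\<phi> (z x $ i) + e x * z x $ i = map_vec (\<lambda>t. \<phi> t + e x * t) (z x) $ i"
        if "x \<in> topspace X" for x
        using zc[OF that] i by simp
    qed
    then have "continuous_map X (euclid_top (n (Suc k))) (\<lambda>x. map_vec (\<lambda>t. \<phi> t + e x * t) (z x))"
      using zc by (auto simp: continuous_map_euclid_top_iff)
    then show ?thesis using False by (simp add: Let_def z_def)
  qed
qed

text \<open>Beyond layer \<open>k\<close> the input enters only through the product of
  \<open>W (Suc k)\<close> with the output of layer \<open>k\<close>.\<close>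

lemma nn_layer_cong:
  assumes "W (Suc k) *\<^sub>v nn_layer L \<phi> W b k x = W (Suc k) *\<^sub>v nn_layer L \<phi> W b k y" "k < m"
  shows "nn_layer L \<phi> W b m x = nn_layer L \<phi> W b m y"
  using \<open>k < m\<close>
proof (induction m)
  case (Suc m)
  then show ?case using assms(1) by (cases "m = k") auto
qed simp

text \<open>The least singular layer is preceded by square invertible layers only, since the width
  can never exceed \<open>n 0\<close>.\<close>

lemma first_singular_layer:
  fixes n :: "nat \<Rightarrow> nat" and W :: "nat \<Rightarrow> real mat"
  assumes "L \<ge> 1"
    and le: "\<And>j. j \<in> {1..L} \<Longrightarrow> n j \<le> n 0"
    and W: "\<And>j. j \<in> {1..L} \<Longrightarrow> W j \<in> carrier_mat (n j) (n (j - 1))"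
    and rank: "Min ((\<lambda>j. mat_rank (W j)) ` {1..L}) < n 0"
  obtains k v where "k < L" "\<And>i. i \<le> k \<Longrightarrow> n i = n 0"
    "v \<in> carrier_vec (n 0)" "v \<noteq> 0\<^sub>v (n 0)" "W (Suc k) *\<^sub>v v = 0\<^sub>v (n (Suc k))"
    "\<And>i v. i \<in> {1..k} \<Longrightarrow> v \<in> carrier_vec (n 0) \<Longrightarrow> W i *\<^sub>v v = 0\<^sub>v (n 0) \<Longrightarrow> v = 0\<^sub>v (n 0)"
proof -
  define P where "P j \<longleftrightarrow> (\<exists>v\<in>carrier_vec (n (j - 1)). v \<noteq> 0\<^sub>v (n (j - 1)) \<and> W j *\<^sub>v v = 0\<^sub>v (n j))" for j
  \<comment> \<open>A drop in width would force a nontrivial kernel, and the width never exceeds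
    \<open>n 0\<close>; hence it stays constant.\<close>
  have dims: "n i = n 0" if "k \<le> L" "\<And>j. j \<in> {1..k} \<Longrightarrow> \<not> P j" "i \<le> k" for i k
    using that
  proof (induction i)
    case (Suc i)
    have "\<not> n (Suc i) < n i"
      using wide_mat_nontrivial_kernel[OF W[of "Suc i"]] Suc.prems(2)[of "Suc i"] Suc.prems(1,3)
      by (auto simp: P_def)
    then show ?case using Suc le[of "Suc i"] by auto
  qed simp
  \<comment> \<open>If all kernels were trivial, all matrices would be square of size
    \<open>n 0\<close>, and one of minimal rank would be singular.\<close>
  have ex: "\<exists>j. j \<in> {1..L} \<and> P j"
  proof (rule ccontr)
    assume "\<not> ?thesis"
    then have n: "n i = n 0" if "i \<le> L" for i using dims[of L i] that by blast
    have "Min ((\<lambda>j. mat_rank (W j)) ` {1..L}) \<in> (\<lambda>j. mat_rank (W j)) ` {1..L}"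
      using \<open>L \<ge> 1\<close> by (intro Min_in) auto
    then obtain j where j: "j \<in> {1..L}" "mat_rank (W j) < n 0" using rank by auto
    have "P j"
      using rank_deficient_nontrivial_kernel[OF _ j(2)] W[OF j(1)] n[of j] n[of "j - 1"] j(1)
      by (auto simp: P_def)
    with \<open>\<not> ?thesis\<close> j(1) show False by blast
  qed
  define j where "j = (LEAST j. j \<in> {1..L} \<and> P j)"
  have j: "j \<in> {1..L}" "P j" using LeastI_ex[OF ex] by (auto simp: j_def)
  have min: "\<not> P i" if "i \<in> {1..j - 1}" for i
  proof -
    have "i < j" "i \<in> {1..L}" using that j(1) by auto
    moreover from \<open>i < j\<close> have "\<not> (i \<in> {1..L} \<and> P i)"
      unfolding j_def by (rule not_less_Least)
    ultimately show ?thesis by simp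
  qed
  have n: "n i = n 0" if "i \<le> j - 1" for i
    using dims[of "j - 1" i] min that j(1) by auto
  obtain v where v: "v \<in> carrier_vec (n 0)" "v \<noteq> 0\<^sub>v (n 0)" "W j *\<^sub>v v = 0\<^sub>v (n j)"
    using j(2) n[of "j - 1"] by (auto simp: P_def)
  show thesis
  proof (rule that[of "j - 1" v])
    show "u = 0\<^sub>v (n 0)"
      if "i \<in> {1..j - 1}" "u \<in> carrier_vec (n 0)" "W i *\<^sub>v u = 0\<^sub>v (n 0)" for i u
      using min[OF that(1)] that n[of i] n[of "i - 1"] by (auto simp: P_def)
    have "Suc (j - 1) = j" using j(1) by simp
    then show "W (Suc (j - 1)) *\<^sub>v v = 0\<^sub>v (n (Suc (j - 1)))" using v(3) by (simp only:)
    show "j - 1 < L" using j(1) by auto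
  qed (fact n v(1) v(2))+
qed


section \<open>Compactness argument as the perturbation tends to zero\<close>

theorem theorem2p1:
  fixes L :: nat and n :: "nat \<Rightarrow> nat"
    and \<phi> :: "real \<Rightarrow> real"
    and W :: "nat \<Rightarrow> real mat" and b :: "nat \<Rightarrow> real vec"
    and xs :: "real vec"
  assumes "L \<ge> 2"
    and "\<And>j. j \<le> L \<Longrightarrow> n j \<ge> 1"
    and "n L = n 0"
    and "Max (n ` {1..L}) \<le> n 0"
    and "continuous_on UNIV \<phi>"
    and "mono \<phi>"
    and "\<And>j. j \<in> {1..L} \<Longrightarrow> W j \<in> carrier_mat (n j) (n (j - 1))"
    and "\<And>j. j \<in> {1..L} \<Longrightarrow> b j \<in> carrier_vec (n j)"
    and "Min ((\<lambda>j. mat_rank (W j)) ` {1..L}) < n 0"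
    and "attractive_point (n 0) (neural_network L \<phi> W b) xs"
  shows "\<forall>C \<in> connected_components_of
               (subtopology (euclid_top (n 0))
                  (basin_of_attraction (n 0) (neural_network L \<phi> W b) xs)).
           \<not> euclid_bounded (n 0) C"
proof (rule ballI, rule notI)
  define N where "N = n 0"
  define F where "F = neural_network L \<phi> W b"
  define B where "B = basin_of_attraction N F xs"
  define \<psi> where "\<psi> = (\<lambda>e t. \<phi> t + e * t)"
  fix C
  assume "C \<in> connected_components_of
      (subtopology (euclid_top (n 0)) (basin_of_attraction (n 0) (neural_network L \<phi> W b) xs))"
    and "euclid_bounded (n 0) C"
  then have C: "C \<in> connected_components_of (subtopology (euclid_top N) B)"
    and bdd: "euclid_bounded N C"
    by (simp_all add: B_def F_def N_def)
  obtain r where box: "C \<subseteq> euclid_box N r" by (rule euclid_bounded_imp_subset_box[OF bdd])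
  obtain x where x: "x \<in> C" using nonempty_connected_components_of[OF C] by blast
  have xc: "x \<in> carrier_vec N" using x box by (auto simp: euclid_box_def)
  have xB: "x \<in> B" using connectedin_connected_components_of[OF C] x by (auto simp: connectedin_subtopology)

  have cont0: "continuous_map (euclid_top N) (euclid_top (n i)) (nn_layer L \<phi> W b i)" if "i \<le> L" for i
  proof -
    have "continuous_map (euclid_top N) (euclid_top (n i)) (\<lambda>x. nn_layer L (\<lambda>t. \<phi> t + 0 * t) W b i x)"
      by (rule continuous_map_nn_layer[where e = "\<lambda>_. 0" and f = "\<lambda>x. x"])
        (use assms(5,7,8) that in \<open>simp_all add: N_def\<close>)
    then show ?thesis by simp
  qed
  have contF: "continuous_map (euclid_top N) (euclid_top N) F"
    using cont0[of L] assms(3) by (simp add: F_def neural_network_def[abs_def] N_def)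
  have openB: "openin (euclid_top N) B"
    unfolding B_def using assms(10) by (intro openin_basin contF) (simp add: F_def N_def)

  have le: "n j \<le> n 0" if "j \<in> {1..L}" for j
    using assms(4) Max_ge[of "n ` {1..L}" "n j"] that by auto
  have "L \<ge> 1" using assms(1) by simp
  obtain k v where k: "k < L" "\<And>i. i \<le> k \<Longrightarrow> n i = N"
    and v: "v \<in> carrier_vec N" "v \<noteq> 0\<^sub>v N" "W (Suc k) *\<^sub>v v = 0\<^sub>v (n (Suc k))"
    and inj: "\<And>i v. i \<in> {1..k} \<Longrightarrow> v \<in> carrier_vec N \<Longrightarrow> W i *\<^sub>v v = 0\<^sub>v N \<Longrightarrow> v = 0\<^sub>v N"
    unfolding N_def
    using first_singular_layer[OF \<open>L \<ge> 1\<close> le assms(7,9)] by metis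
  define A where "A = W (Suc k)"
  have A: "A \<in> carrier_mat (n (Suc k)) N" using assms(7)[of "Suc k"] k by (simp add: A_def)
  define H where "H = (\<lambda>e. nn_layer L (\<psi> e) W b k)"

  have exit: "\<exists>y \<in> euclid_box N r - B. A *\<^sub>v H e y = A *\<^sub>v H e x" if "e > 0" for e
  proof (rule fiber_exits_component[OF _ A v[folded A_def] openB C box x])
    show "homeomorphic_map (euclid_top N) (euclid_top N) (H e)"
      unfolding H_def
    proof (rule homeomorphic_map_nn_layer)
      show "homeomorphic_map euclideanreal euclideanreal (\<psi> e)"
        unfolding \<psi>_def by (rule homeomorphic_map_add_linear[OF assms(5,6) that])
      fix i assume i: "i \<in> {1..k}"
      show "W i \<in> carrier_mat N N" using assms(7)[of i] k(1) k(2)[of i] k(2)[of "i - 1"] i by auto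
      show "b i \<in> carrier_vec N" using assms(8)[of i] k(1) k(2)[of i] i by auto
    qed (use inj k in auto)
  qed

  text \<open>The pairs of a parameter and an exit point form a compact set; its projection to the
    parameters is closed and contains all of \<open>{0<..1}\<close>, hence also \<open>0\<close>.\<close>
  define X where "X = prod_topology euclideanreal (euclid_top N)"
  \<comment> \<open>The fibre condition becomes finitely many real equations, each continuous in the
    pair \<open>p\<close> of slope and point, so that its solution set is closed.\<close>
  define D where "D = (\<lambda>i p. (A *\<^sub>v H (fst p) (snd p)) $ i - (A *\<^sub>v H (fst p) x) $ i)"
  define Z where "Z = ({0..1} \<times> euclid_box N r) \<inter>
    ({p \<in> topspace X. snd p \<in> topspace (euclid_top N) - B} \<inter>
     {p \<in> topspace X. \<forall>i\<in>{..<n (Suc k)}. D i p = 0})"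
  have fstc: "continuous_map X euclideanreal fst" and sndc: "continuous_map X (euclid_top N) snd"
    by (simp_all add: X_def continuous_map_fst continuous_map_snd)
  \<comment> \<open>Applied below with \<open>f\<close> as \<open>snd\<close> and as the constant
    \<open>x\<close>, the two sides of the fibre condition.\<close>
  have AHc: "continuous_map X (euclid_top (n (Suc k))) (\<lambda>p. A *\<^sub>v H (fst p) (f p))"
    if "continuous_map X (euclid_top N) f" for f
  proof (rule continuous_map_mult_mat_vec[OF A])
    have "continuous_map X (euclid_top (n k)) (\<lambda>p. nn_layer L (\<lambda>t. \<phi> t + fst p * t) W b k (f p))"
      by (rule continuous_map_nn_layer[where e = fst and f = f])
        (use assms(5,7,8) that fstc k(1) in \<open>simp_all add: N_def\<close>)
    then show "continuous_map X (euclid_top N) (\<lambda>p. H (fst p) (f p))"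
      using k(2)[of k] by (simp add: H_def \<psi>_def)
  qed
  have Dc: "continuous_map X euclideanreal (D i)" if "i < n (Suc k)" for i
    unfolding D_def
    using AHc[OF sndc] AHc[of "\<lambda>_. x"] xc that
    by (intro continuous_map_diff) (auto simp: continuous_map_euclid_top_iff)
  have "closedin X {p \<in> topspace X. \<forall>i\<in>{..<n (Suc k)}. D i p = 0}"
  proof -
    have "closedin X {p \<in> topspace X. D i p \<in> {0}}" if "i < n (Suc k)" for i
      by (rule closedin_continuous_map_preimage[OF Dc[OF that]]) simp
    \<comment> \<open>\<open>closedin_Inter\<close> asks for a nonempty family, hence the case
      split.\<close>
    then have "closedin X (topspace X \<inter> (\<Inter>i\<in>{..<n (Suc k)}. {p \<in> topspace X. D i p \<in> {0}}))"
      by (cases "n (Suc k) = 0") (auto intro!: closedin_Inter closedin_Int)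
    moreover have "topspace X \<inter> (\<Inter>i\<in>{..<n (Suc k)}. {p \<in> topspace X. D i p \<in> {0}}) =
        {p \<in> topspace X. \<forall>i\<in>{..<n (Suc k)}. D i p = 0}" by auto
    ultimately show ?thesis by (simp only:)
  qed
  moreover have "closedin X {p \<in> topspace X. snd p \<in> topspace (euclid_top N) - B}"
    by (rule closedin_continuous_map_preimage[OF sndc])
      (rule closedin_diff[OF closedin_topspace openB])
  moreover have "compactin X ({0..1} \<times> euclid_box N r)"
    using compactin_euclid_box[of N r] by (simp add: X_def compactin_Times)
  ultimately have "compactin X Z"
    unfolding Z_def by (intro compact_Int_closedin closedin_Int)
  from image_compactin[OF this fstc] have closed: "closed (fst ` Z)"
    by (simp add: compact_imp_closed)
  have memZ: "(e, y) \<in> Z \<longleftrightarrow> e \<in> {0..1} \<and> y \<in> euclid_box N r - B \<and> A *\<^sub>v H e y = A *\<^sub>v H e x" for e y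
  proof -
    have "A *\<^sub>v H e y = A *\<^sub>v H e x \<longleftrightarrow> (\<forall>i\<in>{..<n (Suc k)}. D i (e, y) = 0)"
      using A by (auto simp: D_def vec_eq_iff)
    then show ?thesis
      by (auto simp: Z_def X_def euclid_box_def)
  qed
  have "{0<..1} \<subseteq> fst ` Z"
  proof
    fix e :: real assume e: "e \<in> {0<..1}"
    then obtain y where "y \<in> euclid_box N r - B" "A *\<^sub>v H e y = A *\<^sub>v H e x" using exit by auto
    then have "(e, y) \<in> Z" using memZ e by auto
    then show "e \<in> fst ` Z" by force
  qed
  then have "closure {0<..1} \<subseteq> fst ` Z" using closed by (intro closure_minimal)
  moreover have "(0::real) \<in> closure {0<..1}" by simp
  ultimately have "0 \<in> fst ` Z" by blast
  then obtain y where "(0, y) \<in> Z" by auto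
  then have y: "y \<in> carrier_vec N" "y \<notin> B" and eq: "A *\<^sub>v H 0 y = A *\<^sub>v H 0 x"
    using memZ by (auto simp: euclid_box_def)
  \<comment> \<open>At slope 0 the activation \<open>\<psi> 0\<close> is \<open>\<phi>\<close>, so
    \<open>H 0\<close> is the actual initial part of \<open>F\<close>, and all later layers agree on
    \<open>x\<close> and \<open>y\<close>.\<close>
  have "F y = F x"
    using eq nn_layer_cong[of W k L \<phi> b y x L] k(1)
    by (simp add: F_def neural_network_def A_def H_def \<psi>_def)
  \<comment> \<open>The basin is forward invariant, so it contains \<open>F x\<close>, which is also
    the first iterate of \<open>y\<close>; pulling back puts \<open>y\<close> in the basin.\<close>
  then have "(F ^^ 1) y \<in> B" using basin_image[OF contF] xB by (simp add: B_def)
  then have "y \<in> B" unfolding B_def using y(1) by (rule funpow_in_basin_imp[where k = 1])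
  with y(2) show False by blast
qed

end
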